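(* Let $(\bar x,\bar\lambda)\in\mathbb{R}^n\times\mathbb{R}^{m+1}$ be a solution to the KKT system $$\nabla f(x)+\nabla\Phi(x)^*\lambda=0,\qquad \lambda\in N_{\mathcal Q}(\Phi(x)),$$ and let the second-order sufficient condition (SOSC, see context) hold at $(\bar x,\bar\lambda)$. If the multiplier mapping $M_{\bar x}$ is calm at $((0,0),\bar\lambda)$, then there exist constants $\gamma_1>0$ and $\kappa_1\ge 0$ such that $$\|x-\bar x\|+\mathrm{dist}\big(\lambda;\Lambda(\bar x)\big)\le\kappa_1\,\sigma(x,\lambda)\quad\text{for all }(x,\lambda)\in\mathbb{B}_{\gamma_1}(\bar x,\bar\lambda),$$ where $\sigma(x,\lambda):=\|\nabla_xL(x,\lambda)\|+\|\Phi(x)-\Pi_{\mathcal Q}(\Phi(x)+\lambda)\|$.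
   Context: Setting: the second-order cone program "minimize $f(x)$ subject to $\Phi(x)\in\mathcal Q$", where $f:\mathbb{R}^n\to\mathbb{R}$ and $\Phi:\mathbb{R}^n\to\mathbb{R}^{m+1}$ are twice continuously differentiable around the reference point $\bar x$, and $\mathcal Q:=\{y=(y_0,y_r)\in\mathbb{R}\times\mathbb{R}^m\mid\|y_r\|\le y_0\}$. Norms are Euclidean; $\mathbb{B}$ is the closed unit ball of the space in question, $\mathbb{B}_\gamma(z)$ is the closed ball of radius $\gamma$ centered at $z$; $A^*$ is the transpose of $A$; $\mathrm{dist}(\cdot;\Omega)$ is the distance to a set and $\Pi_\Omega$ the projection onto it. The Lagrangian is $L(x,\lambda):=f(x)+\langle\lambda,\Phi(x)\rangle$. $T_{\mathcal Q}(y)$ and $N_{\mathcal Q}(y)$ are the tangent cone and the convex-analysis normal cone to $\mathcal Q$ at $y\in\mathcal Q$ (with $N_{\mathcal Q}(y)=\emptyset$ for $y\notin\mathcal Q$). For $y\in\mathcal Q$, $v\in N_{\mathcal Q}(y)$, the critical cone is $K_{\mathcal Q}(y,v):=T_{\mathcal Q}(y)\cap\{v\}^\perp$. The set of Lagrange multipliers is $\Lambda(\bar x):=\{\lambda\in\mathbb{R}^{m+1}\mid\nabla_xL(\bar x,\lambda)=0,\ \lambda\in N_{\mathcal Q}(\Phi(\bar x))\}$. For $\varphi:\mathbb{R}^p\to(-\infty,\infty]$ with $\varphi(\bar z)$ finite and $\bar v\in\mathbb{R}^p$, the second subderivative of $\varphi$ at $\bar z$ for $\bar v$ is $$\mathrm{d}^2\varphi(\bar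 z,\bar v)(w):=\liminf_{t\downarrow0,\;w'\to w}\frac{\varphi(\bar z+tw')-\varphi(\bar z)-t\langle\bar v,w'\rangle}{\tfrac12t^2}.$$ $\delta_{\mathcal Q}$ is the indicator function of $\mathcal Q$ ($0$ on $\mathcal Q$, $\infty$ outside). SOSC at $(\bar x,\bar\lambda)$: $\langle\nabla^2_{xx}L(\bar x,\bar\lambda)w,w\rangle+\mathrm{d}^2\delta_{\mathcal Q}(\Phi(\bar x),\bar\lambda)(\nabla\Phi(\bar x)w)>0$ for all $w\in\mathbb{R}^n\setminus\{0\}$ with $\nabla\Phi(\bar x)w\in K_{\mathcal Q}(\Phi(\bar x),\bar\lambda)$. The multiplier mapping $M_{\bar x}:\mathbb{R}^n\times\mathbb{R}^{m+1}\rightrightarrows\mathbb{R}^{m+1}$ is $M_{\bar x}(v,w):=\{\lambda\mid\nabla_xL(\bar x,\lambda)=v,\ \lambda\in N_{\mathcal Q}(\Phi(\bar x)+w)\}$. A set-valued mapping $F$ is calm at $(\bar p,\bar q)\in\mathrm{gph}\,F$ if there exist $\ell\ge0$ and neighborhoods $U$ of $\bar p$, $V$ of $\bar q$ with $F(p)\cap V\subset F(\bar p)+\ell\|p-\bar p\|\mathbb{B}$ for all $p\in U$. *)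

theory Defs
  imports "HOL-Analysis.Analysis"
begin

definition C2_around :: "('a::euclidean_space \<Rightarrow> 'b::euclidean_space) \<Rightarrow> 'a \<Rightarrow> bool" where
  "C2_around g z \<longleftrightarrow>
     (\<exists>U (g' :: 'a \<Rightarrow> 'a \<Rightarrow>\<^sub>L 'b) (g'' :: 'a \<Rightarrow> 'a \<Rightarrow>\<^sub>L ('a \<Rightarrow>\<^sub>L 'b)).
        open U \<and> z \<in> U \<and>
        (\<forall>x\<in>U. (g has_derivative blinfun_apply (g' x)) (at x)) \<and>
        (\<forall>x\<in>U. (g' has_derivative blinfun_apply (g'' x)) (at x)) \<and>
        continuous_on U g'')"

definition grad :: "('a::euclidean_space \<Rightarrow> real) \<Rightarrow> 'a \<Rightarrow> 'a" where
  "grad g x = (THE d. GDERIV g x :> d)"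

(* The Hessian of g at x as the linear map w |-> (Hess g)(x) w: the derivative of the gradient field. *)
definition hess :: "('a::euclidean_space \<Rightarrow> real) \<Rightarrow> 'a \<Rightarrow> 'a \<Rightarrow> 'a" where
  "hess g x = frechet_derivative (grad g) (at x)"

(* R^(m+1) is modelled as real \<times> (real ^ 'm), whose library inner product and norm are the Euclidean ones. *)
definition SOC :: "(real \<times> (real ^ 'm)) set" where
  "SOC = {y. norm (snd y) \<le> fst y}"

(* Bouligand (contingent) tangent cone. *)
definition tangent_cone :: "'a::euclidean_space set \<Rightarrow> 'a \<Rightarrow> 'a set" where
  "tangent_cone C y =
     {w. \<exists>(t :: nat \<Rightarrow> real) (u :: nat \<Rightarrow> 'a).
           (\<forall>k. 0 < t k) \<and> t \<longlonglongrightarrow> 0 \<and> u \<longlonglongrightarrow> w \<and> (\<forall>k. y + t k *\<^sub>R u k \<in> C)}"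

definition normal_cone :: "'a::euclidean_space set \<Rightarrow> 'a \<Rightarrow> 'a set" where
  "normal_cone C y = (if y \<in> C then {v. \<forall>z\<in>C. v \<bullet> (z - y) \<le> 0} else {})"

definition critical_cone :: "'a::euclidean_space set \<Rightarrow> 'a \<Rightarrow> 'a \<Rightarrow> 'a set" where
  "critical_cone C y v = tangent_cone C y \<inter> {w. v \<bullet> w = 0}"

definition indicator_fun :: "'a set \<Rightarrow> 'a \<Rightarrow> ereal" where
  "indicator_fun C y = (if y \<in> C then 0 else \<infinity>)"

(* The limit inferior over t > 0, t -> 0 and w' -> w jointly; w' = w is allowed. *)
definition second_subderiv ::
  "('a::euclidean_space \<Rightarrow> ereal) \<Rightarrow> 'a \<Rightarrow> 'a \<Rightarrow> 'a \<Rightarrow> ereal" where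
  "second_subderiv \<phi> z v w =
     Liminf (at_right 0 \<times>\<^sub>F nhds w)
       (\<lambda>(t :: real, w'). (\<phi> (z + t *\<^sub>R w') - \<phi> z - ereal (t * (v \<bullet> w'))) / ereal (1 / 2 * t\<^sup>2))"

definition lagrangian ::
  "('a::euclidean_space \<Rightarrow> real) \<Rightarrow> ('a \<Rightarrow> 'b::euclidean_space) \<Rightarrow> 'a \<Rightarrow> 'b \<Rightarrow> real" where
  "lagrangian f \<Phi> x lam = f x + lam \<bullet> \<Phi> x"

definition grad_lagrangian ::
  "('a::euclidean_space \<Rightarrow> real) \<Rightarrow> ('a \<Rightarrow> 'b::euclidean_space) \<Rightarrow> 'a \<Rightarrow> 'b \<Rightarrow> 'a" where
  "grad_lagrangian f \<Phi> x lam = grad (\<lambda>u. lagrangian f \<Phi> u lam) x"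

definition hess_lagrangian ::
  "('a::euclidean_space \<Rightarrow> real) \<Rightarrow> ('a \<Rightarrow> 'b::euclidean_space) \<Rightarrow> 'a \<Rightarrow> 'b \<Rightarrow> 'a \<Rightarrow> 'a" where
  "hess_lagrangian f \<Phi> x lam = hess (\<lambda>u. lagrangian f \<Phi> u lam) x"

definition KKT ::
  "(real ^ 'n \<Rightarrow> real) \<Rightarrow> (real ^ 'n \<Rightarrow> real \<times> (real ^ 'm)) \<Rightarrow> real ^ 'n \<Rightarrow> real \<times> (real ^ 'm) \<Rightarrow> bool" where
  "KKT f \<Phi> x lam \<longleftrightarrow>
     grad f x + adjoint (frechet_derivative \<Phi> (at x)) lam = 0 \<and> lam \<in> normal_cone SOC (\<Phi> x)"

definition multipliers ::
  "(real ^ 'n \<Rightarrow> real) \<Rightarrow> (real ^ 'n \<Rightarrow> real \<times> (real ^ 'm)) \<Rightarrow> real ^ 'n \<Rightarrow> (real \<times> (real ^ 'm)) set" where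
  "multipliers f \<Phi> x = {lam. grad_lagrangian f \<Phi> x lam = 0 \<and> lam \<in> normal_cone SOC (\<Phi> x)}"

definition SOSC ::
  "(real ^ 'n \<Rightarrow> real) \<Rightarrow> (real ^ 'n \<Rightarrow> real \<times> (real ^ 'm)) \<Rightarrow> real ^ 'n \<Rightarrow> real \<times> (real ^ 'm) \<Rightarrow> bool" where
  "SOSC f \<Phi> x lam \<longleftrightarrow>
     (\<forall>w. w \<noteq> 0 \<and> frechet_derivative \<Phi> (at x) w \<in> critical_cone SOC (\<Phi> x) lam \<longrightarrow>
        ereal (hess_lagrangian f \<Phi> x lam w \<bullet> w)
          + second_subderiv (indicator_fun SOC) (\<Phi> x) lam (frechet_derivative \<Phi> (at x) w) > 0)"

definition multiplier_map ::
  "(real ^ 'n \<Rightarrow> real) \<Rightarrow> (real ^ 'n \<Rightarrow> real \<times> (real ^ 'm)) \<Rightarrow> real ^ 'n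
     \<Rightarrow> (real ^ 'n) \<times> (real \<times> (real ^ 'm)) \<Rightarrow> (real \<times> (real ^ 'm)) set" where
  "multiplier_map f \<Phi> x =
     (\<lambda>(v, w). {lam. grad_lagrangian f \<Phi> x lam = v \<and> lam \<in> normal_cone SOC (\<Phi> x + w)})"

definition calm_at ::
  "('p::real_normed_vector \<Rightarrow> 'q::real_normed_vector set) \<Rightarrow> 'p \<Rightarrow> 'q \<Rightarrow> bool" where
  "calm_at F p q \<longleftrightarrow> q \<in> F p \<and>
     (\<exists>l\<ge>0. \<exists>U V. open U \<and> p \<in> U \<and> open V \<and> q \<in> V \<and>
        (\<forall>p'\<in>U. F p' \<inter> V \<subseteq> {a + (l * norm (p' - p)) *\<^sub>R b | a b. a \<in> F p \<and> b \<in> cball 0 1}))"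

definition kkt_residual ::
  "(real ^ 'n \<Rightarrow> real) \<Rightarrow> (real ^ 'n \<Rightarrow> real \<times> (real ^ 'm)) \<Rightarrow> real ^ 'n \<Rightarrow> real \<times> (real ^ 'm) \<Rightarrow> real" where
  "kkt_residual f \<Phi> x lam =
     norm (grad_lagrangian f \<Phi> x lam) + norm (\<Phi> x - closest_point SOC (\<Phi> x + lam))"

end

theory Submission
  imports Defs
begin

text \<open>
  The projection residual \<open>e\<close> turns \<open>(x, \<lambda>)\<close> into a pair with \<open>\<lambda> - e\<close> normal to the cone at
  \<open>\<Phi> x + e\<close>, so calmness yields a multiplier \<open>\<nu>\<close> at the reference point with
  \<open>\<lambda> - e - \<nu> = O(\<parallel>x - xbar\<parallel> + \<sigma>)\<close>. It remains to prove \<open>\<parallel>x - xbar\<parallel> = O(\<sigma>)\<close>. If this fails along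
  a sequence, let \<open>w\<close> and \<open>\<eta>\<close> be limits of \<open>(x - xbar) / \<parallel>x - xbar\<parallel>\<close> and
  \<open>(\<lambda> - e - \<nu>) / \<parallel>x - xbar\<parallel>\<close>. Expanding the gradient of the Lagrangian gives
  \<open>H w \<bullet> w + \<eta> \<bullet> D w = 0\<close>, where \<open>D\<close> is the derivative of \<open>\<Phi>\<close> and \<open>H\<close> the Hessian, while \<open>D w\<close> is
  critical and the second subderivative of the indicator at \<open>D w\<close> is at most \<open>\<eta> \<bullet> D w\<close>. This
  contradicts the second-order condition.
\<close>

section \<open>Second subderivatives of indicator functions\<close>

text \<open>A lower limit is at most the limit along any sequence tending to the base of the filter.
  Along feasible points both indicator terms vanish, which leaves the quotient
  \<open>- 2 * (v \<bullet> u k) / t k\<close>.\<close>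

lemma second_subderiv_indicator_le:
  fixes C :: "'a::euclidean_space set"
  assumes "z \<in> C" and "\<And>k. 0 < t k" and "t \<longlonglongrightarrow> 0" and "u \<longlonglongrightarrow> w"
    and "\<And>k. z + t k *\<^sub>R u k \<in> C" and "(\<lambda>k. - 2 * (v \<bullet> u k) / t k) \<longlonglongrightarrow> c"
  shows "second_subderiv (indicator_fun C) z v w \<le> ereal c"
proof -
  let ?F = "at_right (0::real) \<times>\<^sub>F nhds w"
  let ?g = "\<lambda>(t :: real, w'). (indicator_fun C (z + t *\<^sub>R w') - indicator_fun C z
      - ereal (t * (v \<bullet> w'))) / ereal (1 / 2 * t\<^sup>2)"
  have "filterlim t (at_right 0) sequentially"
    using assms(2,3) by (simp add: filterlim_at less_imp_neq[symmetric])
  with assms(4) have "filterlim (\<lambda>k. (t k, u k)) ?F sequentially"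
    by (intro filterlim_Pair)
  then have le: "filtermap (\<lambda>k. (t k, u k)) sequentially \<le> ?F"
    by (simp add: filterlim_def)
  have val: "?g (t k, u k) = ereal (- 2 * (v \<bullet> u k) / t k)" for k
    using assms(1) assms(2)[of k] assms(5)[of k]
    by (simp add: indicator_fun_def field_simps power2_eq_square)
  have "Liminf ?F ?g \<le> Liminf (filtermap (\<lambda>k. (t k, u k)) sequentially) ?g"
    using le by (auto simp: Liminf_def le_filter_def intro!: SUP_subset_mono)
  also have "\<dots> \<le> Liminf sequentially (\<lambda>k. ?g (t k, u k))"
    by (rule Liminf_filtermap_le)
  also have "\<dots> = ereal c"
    using assms(6) by (intro lim_imp_Liminf) (simp_all only: val lim_ereal sequentially_bot not_False_eq_True)
  finally show ?thesis
    by (simp add: second_subderiv_def)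
qed

section \<open>The second-order cone: projection, normals and second-order limits\<close>

lemma closed_SOC: "closed (SOC :: (real \<times> (real ^ 'm)) set)"
  unfolding SOC_def by (intro closed_Collect_le continuous_intros)

lemma convex_SOC: "convex (SOC :: (real \<times> (real ^ 'm)) set)"
proof (rule convexI)
  fix x y :: "real \<times> (real ^ 'm)" and a b :: real
  assume *: "x \<in> SOC" "y \<in> SOC" "0 \<le> a" "0 \<le> b" "a + b = 1"
  have "norm (a *\<^sub>R snd x + b *\<^sub>R snd y) \<le> a * norm (snd x) + b * norm (snd y)"
    using * by (intro norm_triangle_le) simp
  also have "\<dots> \<le> a * fst x + b * fst y"
    using * by (intro add_mono mult_left_mono) (auto simp: SOC_def)
  finally show "a *\<^sub>R x + b *\<^sub>R y \<in> SOC"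
    by (simp add: SOC_def)
qed

lemma zero_in_SOC: "0 \<in> SOC"
  by (simp add: SOC_def)

lemma scaleR_in_SOC_iff: "0 < a \<Longrightarrow> a *\<^sub>R y \<in> SOC \<longleftrightarrow> y \<in> SOC"
  by (simp add: SOC_def)

text \<open>The variational inequality of the projection is the normal-cone condition at the
  projected point. It converts the projection term of the KKT residual into a normal-cone
  inclusion.\<close>

lemma closest_point_residual_normal:
  assumes "convex C" "closed C" "C \<noteq> {}"
  shows "a - closest_point C a \<in> normal_cone C (closest_point C a)"
  using assms by (auto simp: normal_cone_def closest_point_in_set intro: closest_point_dot)

text \<open>Half the gradient of the quadratic form squared \<open>norm (snd y)\<close> minus
  squared \<open>fst y\<close>. The product \<open>cone_reflect y \<bullet> y\<close> is that form
  itself, which vanishes on the boundary of the cone; at a nonzero boundary point the reflection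
  spans the normal ray.\<close>

definition cone_reflect :: "real \<times> 'a \<Rightarrow> real \<times> 'a" where
  "cone_reflect y = (- fst y, snd y)"

lemma norm_cone_reflect: "norm (cone_reflect y) = norm y"
  by (simp add: cone_reflect_def norm_prod_def)

lemma bounded_linear_cone_reflect:
  "bounded_linear (cone_reflect :: real \<times> 'a::real_normed_vector \<Rightarrow> _)"
  unfolding cone_reflect_def
  by (intro bounded_linear_Pair bounded_linear_minus bounded_linear_fst bounded_linear_snd)

lemma cone_reflect_inner_commute:
  "cone_reflect x \<bullet> y = cone_reflect y \<bullet> (x :: real \<times> 'a::real_inner)"
  by (simp add: cone_reflect_def inner_prod_def inner_commute)

text \<open>With \<open>v = (a, b)\<close> and \<open>y = (s, r)\<close>, orthogonality gives
  \<open>- a * s = b \<bullet> r\<close>, while Cauchy-Schwarz, \<open>norm b \<le> - a\<close> and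
  \<open>norm r \<le> s\<close> bound the right side by \<open>- a * s\<close> again. All
  inequalities are then equalities: \<open>y\<close> is on the boundary and \<open>b\<close> is
  parallel to \<open>r\<close>.\<close>

lemma normal_cone_SOC_boundary:
  fixes y v :: "real \<times> (real ^ 'm)"
  assumes "v \<in> normal_cone SOC y" "v \<noteq> 0" "y \<noteq> 0"
  shows "v = (norm v / norm y) *\<^sub>R cone_reflect y" and "cone_reflect y \<bullet> y = 0"
proof -
  obtain a b where v: "v = (a, b)" by fastforce
  obtain s r where y: "y = (s, r)" by fastforce
  from assms(1) have yS: "y \<in> SOC" and N: "\<And>z. z \<in> SOC \<Longrightarrow> v \<bullet> (z - y) \<le> 0"
    by (auto simp: normal_cone_def split: if_splits)
  have sr: "norm r \<le> s" using yS by (simp add: SOC_def y)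
  \<comment> \<open>Testing at twice \<open>y\<close> and at the origin gives orthogonality of
    \<open>v\<close> and \<open>y\<close>, hence membership of \<open>v\<close> in the polar
    cone.\<close>
  have "v \<bullet> (2 *\<^sub>R y - y) \<le> 0" by (rule N) (use yS in \<open>simp add: scaleR_in_SOC_iff\<close>)
  moreover have "v \<bullet> (0 - y) \<le> 0" by (rule N) (rule zero_in_SOC)
  ultimately have vy: "v \<bullet> y = 0" by (simp add: inner_diff_right)
  have pol: "v \<bullet> z \<le> 0" if "z \<in> SOC" for z
    using N[OF that] vy by (simp add: inner_diff_right)
  \<comment> \<open>The polar of the cone is its negative. The test point \<open>(norm b, b)\<close>
    is informative only for \<open>b \<noteq> 0\<close>; otherwise the axis point
    \<open>(1, 0)\<close> gives the sign of \<open>a\<close>.\<close>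
  have ab: "norm b \<le> - a"
  proof (cases "b = 0")
    case True
    then show ?thesis using pol[of "(1, 0)"] by (simp add: SOC_def v)
  next
    case False
    have "v \<bullet> (norm b, b) \<le> 0" by (rule pol) (simp add: SOC_def)
    then have "norm b * (a + norm b) \<le> 0"
      by (simp add: v algebra_simps power2_norm_eq_inner[symmetric] power2_eq_square)
    then show ?thesis using False by (simp add: mult_le_0_iff)
  qed
  have a: "a < 0" using ab assms(2) v norm_ge_zero[of b] by (cases "a = 0") (auto simp: zero_prod_def simp del: norm_ge_zero)
  have s: "s > 0" using sr assms(3) y norm_ge_zero[of r] by (cases "s = 0") (auto simp: zero_prod_def simp del: norm_ge_zero)
  have e0: "- a * s = b \<bullet> r" using vy by (simp add: v y)
  have e1: "b \<bullet> r \<le> norm b * norm r" by (rule norm_cauchy_schwarz)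
  have e2: "norm b * norm r \<le> - a * norm r" using ab by (intro mult_right_mono) auto
  have e3: "- a * norm r \<le> - a * s" using sr a by (intro mult_left_mono) auto
  have "- a * norm r = - a * s" using e0 e1 e2 e3 by linarith
  then have r: "norm r = s" using a by simp
  have "norm b * s = - a * s" using e0 e1 e2 r by simp
  then have b: "norm b = - a" using s by (simp only: mult_cancel_right) simp
  have "b \<bullet> r = norm b * norm r" using e0 r b by simp
  then have "norm b *\<^sub>R r = norm r *\<^sub>R b" by (simp add: norm_cauchy_schwarz_eq)
  then have "(1 / s) *\<^sub>R (s *\<^sub>R b) = (1 / s) *\<^sub>R (- a *\<^sub>R r)" using b r by simp
  then have br: "b = (- a / s) *\<^sub>R r" using s by simp
  have "v = (- a / s) *\<^sub>R cone_reflect y"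
    using s br by (simp add: v y cone_reflect_def)
  moreover from this have "norm v = (- a / s) * norm y"
    using a s by (metis abs_of_nonneg divide_nonneg_pos less_imp_le neg_0_le_iff_le norm_cone_reflect norm_scaleR)
  ultimately show "v = (norm v / norm y) *\<^sub>R cone_reflect y"
    using assms(3) by simp
  show "cone_reflect y \<bullet> y = 0"
    using r by (simp add: y cone_reflect_def power2_norm_eq_inner[symmetric] power2_eq_square)
qed

text \<open>The case split avoids computing the second subderivative: if the multiplier or the base point
  vanishes then \<open>0\<close> is an upper bound; otherwise both normal cones are rays spanned by reflected
  boundary points, and the difference quotients of the indicator along the given sequence converge
  exactly to \<open>\<eta> \<bullet> q\<close>.\<close>

lemma SOC_multiplier_limit:
  fixes y q l \<eta> :: "real \<times> (real ^ 'm)"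
  assumes t: "\<And>k. 0 < t k" "t \<longlonglongrightarrow> 0" and u: "u \<longlonglongrightarrow> q"
    and l: "l \<in> normal_cone SOC y"
    and \<nu>: "\<And>k. \<nu> k \<in> normal_cone SOC y"
    and \<mu>: "\<And>k. \<mu> k \<in> normal_cone SOC (y + t k *\<^sub>R u k)" "\<mu> \<longlonglongrightarrow> l"
    and \<eta>: "(\<lambda>k. (\<mu> k - \<nu> k) /\<^sub>R t k) \<longlonglongrightarrow> \<eta>"
  shows "q \<in> critical_cone SOC y l"
    and "second_subderiv (indicator_fun SOC) y l q \<le> ereal (\<eta> \<bullet> q)"
proof -
  have yS: "y \<in> SOC" using l by (auto simp: normal_cone_def split: if_splits)
  have ykS: "y + t k *\<^sub>R u k \<in> SOC" for k
    using \<mu>(1)[of k] by (auto simp: normal_cone_def split: if_splits)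
  \<comment> \<open>Monotonicity of the normal cone, split into two halves with
    \<open>mono2\<close>. In the limit they enclose \<open>l \<bullet> q\<close> from both sides,
    and combined they give \<open>0 \<le> \<eta> \<bullet> q\<close>.\<close>
  have mono1: "v \<bullet> u k \<le> 0" if "v \<in> normal_cone SOC y" for v k
  proof -
    have "v \<bullet> (y + t k *\<^sub>R u k - y) \<le> 0"
      using that ykS[of k] unfolding normal_cone_def by (auto split: if_splits)
    then show ?thesis using t(1)[of k] by (simp add: mult_le_0_iff)
  qed
  have mono2: "0 \<le> \<mu> k \<bullet> u k" for k
  proof -
    have "\<mu> k \<bullet> (y - (y + t k *\<^sub>R u k)) \<le> 0"
      using \<mu>(1)[of k] yS unfolding normal_cone_def by (auto split: if_splits)
    then show ?thesis using t(1)[of k] by (simp add: zero_le_mult_iff)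
  qed
  have "l \<bullet> q \<le> 0"
    by (rule LIMSEQ_le_const2[OF tendsto_inner[OF tendsto_const u]]) (use mono1[OF l] in auto)
  moreover have "0 \<le> l \<bullet> q"
    by (rule LIMSEQ_le_const[OF tendsto_inner[OF \<mu>(2) u]]) (use mono2 in auto)
  ultimately have lq: "l \<bullet> q = 0" by simp
  have "q \<in> tangent_cone SOC y"
    unfolding tangent_cone_def using t u ykS by blast
  with lq show "q \<in> critical_cone SOC y l"
    by (simp add: critical_cone_def)
  have \<eta>q: "0 \<le> \<eta> \<bullet> q"
  proof (rule LIMSEQ_le_const[OF tendsto_inner[OF \<eta> u]], intro exI allI impI)
    fix k
    show "0 \<le> ((\<mu> k - \<nu> k) /\<^sub>R t k) \<bullet> u k"
      using mono1[OF \<nu>, of k k] mono2[of k] t(1)[of k] by (simp add: inner_diff_left)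
  qed
  show "second_subderiv (indicator_fun SOC) y l q \<le> ereal (\<eta> \<bullet> q)"
  proof (cases "l = 0 \<or> y = 0")
    case True
    have "second_subderiv (indicator_fun SOC) y l q \<le> ereal 0"
    proof (cases "l = 0")
      case True
      then show ?thesis
        by (intro second_subderiv_indicator_le[of y SOC t u]) (use t u yS ykS in auto)
    next
      case False
      with \<open>l = 0 \<or> y = 0\<close> have y0: "y = 0" by simp
      then have "u k \<in> SOC" for k
        using ykS[of k] t(1)[of k] by (simp add: scaleR_in_SOC_iff)
      then have "q \<in> SOC"
        using closed_sequentially[OF closed_SOC _ u] by blast
      \<comment> \<open>The constant direction \<open>q\<close> replaces \<open>u\<close>: its
        quotients vanish because \<open>l \<bullet> q = 0\<close>, whereas those of \<open>u\<close>
        are not known to converge.\<close>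
      then show ?thesis
        by (intro second_subderiv_indicator_le[of y SOC t "\<lambda>_. q"])
          (use t y0 yS lq in \<open>auto simp: scaleR_in_SOC_iff\<close>)
    qed
    also have "\<dots> \<le> ereal (\<eta> \<bullet> q)" using \<eta>q by simp
    finally show ?thesis .
  next
    case False
    then have l0: "l \<noteq> 0" and y0: "y \<noteq> 0" by auto
    define c where "c = norm l / norm y"
    define Q where "Q x = cone_reflect x \<bullet> x" for x :: "real \<times> (real ^ 'm)"
    note lin = bounded_linear.linear[OF bounded_linear_cone_reflect]
    have lc: "l = c *\<^sub>R cone_reflect y" and Qy: "Q y = 0"
      using normal_cone_SOC_boundary[OF l l0 y0] by (auto simp: c_def Q_def)
    \<comment> \<open>Convergence of the quotients and \<open>t\<close> tending to 0 force
      \<open>\<nu>\<close> to tend to \<open>l\<close> as well, so its terms are eventually nonzero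
      and the ray description applies to them.\<close>
    have "(\<lambda>k. t k *\<^sub>R ((\<mu> k - \<nu> k) /\<^sub>R t k)) \<longlonglongrightarrow> 0 *\<^sub>R \<eta>"
      by (intro tendsto_scaleR t \<eta>)
    moreover have "t k *\<^sub>R ((\<mu> k - \<nu> k) /\<^sub>R t k) = \<mu> k - \<nu> k" for k
      using t(1)[of k] by simp
    ultimately have "(\<lambda>k. \<mu> k - \<nu> k) \<longlonglongrightarrow> 0" by simp
    from tendsto_diff[OF \<mu>(2) this] have \<nu>l: "\<nu> \<longlonglongrightarrow> l" by simp
    have yk: "(\<lambda>k. y + t k *\<^sub>R u k) \<longlonglongrightarrow> y"
      using tendsto_add[OF tendsto_const[of y] tendsto_scaleR[OF t(2) u]] by simp
    have Qu: "(\<lambda>k. Q (u k)) \<longlonglongrightarrow> Q q"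
      unfolding Q_def by (intro tendsto_inner u bounded_linear.tendsto[OF bounded_linear_cone_reflect])
    have "\<forall>\<^sub>F k in sequentially. \<mu> k \<noteq> 0 \<and> \<nu> k \<noteq> 0 \<and> y + t k *\<^sub>R u k \<noteq> 0"
      using tendsto_imp_eventually_ne[OF \<mu>(2) l0] tendsto_imp_eventually_ne[OF \<nu>l l0]
        tendsto_imp_eventually_ne[OF yk y0] by eventually_elim auto
    then have ev: "\<forall>\<^sub>F k in sequentially. - 2 * (l \<bullet> u k) / t k = c * Q (u k) \<and>
       ((\<mu> k - \<nu> k) /\<^sub>R t k) \<bullet> u k =
       (norm (\<mu> k) / norm (y + t k *\<^sub>R u k) + norm (\<nu> k) / norm y) / 2 * Q (u k)"
    proof eventually_elim
      case (elim k)
      define d where "d = norm (\<mu> k) / norm (y + t k *\<^sub>R u k)"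
      define e where "e = norm (\<nu> k) / norm y"
      have m: "\<mu> k = d *\<^sub>R cone_reflect (y + t k *\<^sub>R u k)" and Q0: "Q (y + t k *\<^sub>R u k) = 0"
        using normal_cone_SOC_boundary[OF \<mu>(1)[of k]] elim by (auto simp: d_def Q_def)
      have n: "\<nu> k = e *\<^sub>R cone_reflect y"
        using normal_cone_SOC_boundary(1)[OF \<nu>[of k]] elim y0 by (auto simp: e_def)
      \<comment> \<open>The form \<open>Q\<close> vanishes at both \<open>y\<close> and the moved
        point. Its exact second-order expansion between them therefore ties the first-order term to
        \<open>Q (u k)\<close>.\<close>
      have "t k * (2 * (cone_reflect y \<bullet> u k) + t k * Q (u k)) = 0"
        using Q0 Qy cone_reflect_inner_commute[of "u k" y]
        by (simp add: Q_def linear_add[OF lin] linear_scale[OF lin] algebra_simps)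
      then have h: "cone_reflect y \<bullet> u k = - (t k / 2 * Q (u k))"
        using t(1)[of k] by simp
      \<comment> \<open>At the moved point the same product has the opposite sign, so in the
        difference of the normals the coefficients \<open>d\<close> and \<open>e\<close> add up
        instead of cancelling.\<close>
      have "cone_reflect (y + t k *\<^sub>R u k) \<bullet> u k = t k / 2 * Q (u k)"
        using h by (simp add: Q_def linear_add[OF lin] linear_scale[OF lin] algebra_simps)
      then have "(\<mu> k - \<nu> k) \<bullet> u k = t k * ((d + e) / 2 * Q (u k))"
        unfolding m n using h by (simp add: algebra_simps)
      then have "((\<mu> k - \<nu> k) /\<^sub>R t k) \<bullet> u k = (d + e) / 2 * Q (u k)"
        using t(1)[of k] by (simp only: inner_scaleR_left) (simp add: field_simps)
      then show ?case
        using t(1)[of k] h lc by (simp add: d_def e_def)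
    qed
    have "(\<lambda>k. c * Q (u k)) \<longlonglongrightarrow> c * Q q"
      by (intro tendsto_intros Qu)
    then have 1: "(\<lambda>k. - 2 * (l \<bullet> u k) / t k) \<longlonglongrightarrow> c * Q q"
      by (rule Lim_transform_eventually) (use ev in eventually_elim, auto)
    \<comment> \<open>Both coefficients tend to \<open>c\<close>, so their average does too, and the
      limit agrees with that of the indicator quotients.\<close>
    have "(\<lambda>k. (norm (\<mu> k) / norm (y + t k *\<^sub>R u k) + norm (\<nu> k) / norm y) / 2 * Q (u k))
        \<longlonglongrightarrow> (norm l / norm y + norm l / norm y) / 2 * Q q"
      by (intro tendsto_intros Qu \<mu> \<nu>l yk) (use y0 in auto)
    then have "(\<lambda>k. ((\<mu> k - \<nu> k) /\<^sub>R t k) \<bullet> u k) \<longlonglongrightarrow> (norm l / norm y + norm l / norm y) / 2 * Q q"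
      by (rule Lim_transform_eventually) (use ev in eventually_elim, auto)
    from LIMSEQ_unique[OF this tendsto_inner[OF \<eta> u]] have "c * Q q = \<eta> \<bullet> q"
      by (simp add: c_def)
    with second_subderiv_indicator_le[OF yS t u ykS 1] show ?thesis by simp
  qed
qed

section \<open>First and second derivatives of the Lagrangian\<close>

text \<open>Near \<open>z\<close> the remainder is at most \<open>norm (x - z)\<close>, so
  \<open>onorm F' + 1\<close> serves as the constant. One of the two compared points is always
  \<open>z\<close>.\<close>

lemma has_derivative_local_lipschitz:
  assumes "(F has_derivative F') (at z)"
  obtains C where "C \<ge> 0" "\<forall>\<^sub>F x in nhds z. norm (F x - F z) \<le> C * norm (x - z)"
proof -
  from assms have bl: "bounded_linear F'"
    and lim: "((\<lambda>x. norm ((F x - F z) - F' (x - z)) / norm (x - z)) \<longlongrightarrow> 0) (at z)"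
    by (auto simp: has_derivative_iff_norm)
  have "\<forall>\<^sub>F x in at z. norm ((F x - F z) - F' (x - z)) / norm (x - z) < 1"
    using lim by (rule order_tendstoD) simp
  then have "\<forall>\<^sub>F x in nhds z. norm (F x - F z) \<le> (onorm F' + 1) * norm (x - z)"
    unfolding eventually_at_filter
  proof eventually_elim
    case (elim x)
    show ?case
    proof (cases "x = z")
      case False
      then have "norm ((F x - F z) - F' (x - z)) \<le> norm (x - z)"
        using elim by (simp add: divide_less_eq)
      moreover have "norm (F' (x - z)) \<le> onorm F' * norm (x - z)"
        by (rule onorm[OF bl])
      moreover have "norm (F x - F z) \<le> norm ((F x - F z) - F' (x - z)) + norm (F' (x - z))"
        by (metis add.commute diff_add_cancel norm_triangle_ineq)
      ultimately show ?thesis by (simp add: algebra_simps)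
    qed simp
  qed
  with onorm_pos_le[OF bl] show ?thesis by (intro that[of "onorm F' + 1"]) auto
qed

text \<open>The remainder is of smaller order than \<open>norm (x k - z)\<close>, and linearity of
  \<open>F'\<close> moves the scaling onto the direction, which converges to
  \<open>w\<close>.\<close>

lemma has_derivative_direction_seq:
  assumes "(F has_derivative F') (at z)" and "x \<longlonglongrightarrow> z" and "\<And>k. x k \<noteq> z"
    and "(\<lambda>k. (x k - z) /\<^sub>R norm (x k - z)) \<longlonglongrightarrow> w"
  shows "(\<lambda>k. (F (x k) - F z) /\<^sub>R norm (x k - z)) \<longlonglongrightarrow> F' w"
proof -
  from assms(1) have bl: "bounded_linear F'"
    and lim: "((\<lambda>x. norm ((F x - F z) - F' (x - z)) / norm (x - z)) \<longlongrightarrow> 0) (at z)"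
    by (auto simp: has_derivative_iff_norm)
  have "filterlim x (at z) sequentially"
    using assms(2,3) by (auto simp: filterlim_at)
  from filterlim_compose[OF lim this]
  have "(\<lambda>k. norm (((F (x k) - F z) - F' (x k - z)) /\<^sub>R norm (x k - z))) \<longlonglongrightarrow> 0"
    by (simp add: divide_inverse mult.commute)
  then have "(\<lambda>k. ((F (x k) - F z) - F' (x k - z)) /\<^sub>R norm (x k - z)) \<longlonglongrightarrow> 0"
    by (rule tendsto_norm_zero_cancel)
  from tendsto_add[OF this bounded_linear.tendsto[OF bl assms(4)]]
  show ?thesis
    unfolding linear_scale[OF bounded_linear.linear[OF bl]] scaleR_add_right[symmetric] by simp
qed

text \<open>The adjoint applied to 1 represents the derivative by an inner product, and uniqueness
  of derivatives resolves the definite description in \<open>grad\<close>.\<close>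

lemma grad_inner:
  fixes g :: "'a::euclidean_space \<Rightarrow> real"
  assumes "(g has_derivative g') (at x)"
  shows "grad g x \<bullet> v = g' v"
proof -
  have lin: "linear g'"
    using assms has_derivative_linear by blast
  define d where "d = adjoint g' 1"
  have d: "v \<bullet> d = g' v" for v
    using adjoint_works[OF lin, of v 1] by (simp add: d_def)
  have "GDERIV g x :> d"
    using assms by (simp add: gderiv_def d)
  moreover have "e = d" if "GDERIV g x :> e" for e
  proof -
    have "(\<lambda>v. v \<bullet> e) = g'"
      using that assms unfolding gderiv_def by (rule has_derivative_unique)
    then have "v \<bullet> e = v \<bullet> d" for v using d by metis
    then show ?thesis using vector_eq_ldot by blast
  qed
  ultimately have "grad g x = d"
    unfolding grad_def by (rule the_equality)
  then show ?thesis using d[of v] by (metis inner_commute)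
qed

text \<open>The Lagrangian is affine in the multiplier, so differences between two multipliers
  cancel \<open>f\<close> and involve only the derivative of \<open>\<Phi>\<close>. This makes the
  bound on mixed differences uniform over all multipliers.\<close>

lemma C2_around_lagrangian:
  fixes f :: "'a::euclidean_space \<Rightarrow> real" and \<Phi> :: "'a \<Rightarrow> 'b::euclidean_space"
  assumes "C2_around f z" and "C2_around \<Phi> z"
  obtains C where "C \<ge> 0"
    and "(\<Phi> has_derivative frechet_derivative \<Phi> (at z)) (at z)"
    and "\<And>lam. ((\<lambda>x. grad_lagrangian f \<Phi> x lam) has_derivative hess_lagrangian f \<Phi> z lam) (at z)"
    and "\<And>lam mu v. (grad_lagrangian f \<Phi> z lam - grad_lagrangian f \<Phi> z mu) \<bullet> v
           = (lam - mu) \<bullet> frechet_derivative \<Phi> (at z) v"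
    and "\<forall>\<^sub>F x in nhds z. \<forall>lam mu.
           norm ((grad_lagrangian f \<Phi> x lam - grad_lagrangian f \<Phi> z lam)
             - (grad_lagrangian f \<Phi> x mu - grad_lagrangian f \<Phi> z mu))
           \<le> C * norm (x - z) * norm (lam - mu)"
proof -
  let ?G = "grad_lagrangian f \<Phi>"
  obtain U f' f'' where U: "open U" "z \<in> U"
    and f': "\<forall>x\<in>U. (f has_derivative blinfun_apply (f' x)) (at x)"
    and f'': "\<forall>x\<in>U. (f' has_derivative blinfun_apply (f'' x)) (at x)"
    using assms(1) unfolding C2_around_def by blast
  obtain V p p' where V: "open V" "z \<in> V"
    and p: "\<forall>x\<in>V. (\<Phi> has_derivative blinfun_apply (p x)) (at x)"
    and p': "\<forall>x\<in>V. (p has_derivative blinfun_apply (p' x)) (at x)"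
    using assms(2) unfolding C2_around_def by blast
  note f' = f'[rule_format] and f'' = f''[rule_format] and p = p[rule_format] and p' = p'[rule_format]
  \<comment> \<open>The formula is proved on a whole neighbourhood so that it can be differentiated
    once more at \<open>z\<close>.\<close>
  have G: "?G x lam \<bullet> v = f' x v + lam \<bullet> p x v" if "x \<in> U \<inter> V" for x lam v
  proof -
    have "((\<lambda>u. lagrangian f \<Phi> u lam) has_derivative (\<lambda>v. f' x v + lam \<bullet> p x v)) (at x)"
      unfolding lagrangian_def using that
      by (intro has_derivative_add bounded_linear.has_derivative[OF bounded_linear_inner_right] f' p) auto
    then show ?thesis unfolding grad_lagrangian_def by (rule grad_inner)
  qed
  have fd: "frechet_derivative \<Phi> (at z) = p z"
    using p[OF V(2)] by (metis frechet_derivative_at)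
  obtain C where C: "C \<ge> 0" and Clip: "\<forall>\<^sub>F x in nhds z. norm (p x - p z) \<le> C * norm (x - z)"
    using has_derivative_local_lipschitz[OF p'[OF V(2)]] .
  show ?thesis
  proof (rule that[OF C])
    show "(\<Phi> has_derivative frechet_derivative \<Phi> (at z)) (at z)"
      unfolding fd using p V by auto
    show "(?G z lam - ?G z mu) \<bullet> v = (lam - mu) \<bullet> frechet_derivative \<Phi> (at z) v" for lam mu v
      using U V by (simp add: inner_diff_left G fd)
    show "((\<lambda>x. ?G x lam) has_derivative hess_lagrangian f \<Phi> z lam) (at z)" for lam
    proof -
      \<comment> \<open>The gradient is reassembled from its coordinates, each of which is
        differentiable. Mere differentiability suffices, since \<open>hess\<close> is by definition
        the Frechet derivative of the gradient field.\<close>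
      let ?H = "\<lambda>x. \<Sum>i\<in>Basis. (f' x i + lam \<bullet> p x i) *\<^sub>R i"
      have "((\<lambda>x. f' x i + lam \<bullet> p x i) has_derivative (\<lambda>h. f'' z h i + lam \<bullet> p' z h i)) (at z)" for i
        using U V by (intro has_derivative_add bounded_linear.has_derivative[OF bounded_linear_inner_right]
          bounded_linear.has_derivative[OF blinfun.bounded_linear_left] f'' p') auto
      then have H: "((\<lambda>x. ?H x) has_derivative (\<lambda>h. \<Sum>i\<in>Basis. (f'' z h i + lam \<bullet> p' z h i) *\<^sub>R i)) (at z)"
        by (intro has_derivative_sum has_derivative_scaleR_left)
      have HG: "?H x = ?G x lam" if "x \<in> U \<inter> V" for x
        unfolding G[OF that, symmetric] by (rule euclidean_representation)
      have "((\<lambda>x. ?G x lam) has_derivative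
          (\<lambda>h. \<Sum>i\<in>Basis. (f'' z h i + lam \<bullet> p' z h i) *\<^sub>R i)) (at z)"
        by (rule has_derivative_transform_within_open[OF H open_Int[OF U(1) V(1)] _ HG]) (use U V in auto)
      then have "(\<lambda>x. ?G x lam) differentiable (at z)"
        by (rule differentiableI)
      then have "((\<lambda>x. ?G x lam) has_derivative frechet_derivative (\<lambda>x. ?G x lam) (at z)) (at z)"
        by (rule frechet_derivative_works[THEN iffD1])
      then show ?thesis
        by (simp add: hess_lagrangian_def hess_def grad_lagrangian_def[abs_def])
    qed
    have "\<forall>\<^sub>F x in nhds z. x \<in> U \<inter> V"
      using U V by (intro eventually_nhds_in_open) auto
    with Clip show "\<forall>\<^sub>F x in nhds z. \<forall>lam mu.
           norm ((?G x lam - ?G z lam) - (?G x mu - ?G z mu)) \<le> C * norm (x - z) * norm (lam - mu)"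
    proof (eventually_elim, intro allI)
      fix x lam mu
      assume lip: "norm (p x - p z) \<le> C * norm (x - z)" and x: "x \<in> U \<inter> V"
      let ?d = "(?G x lam - ?G z lam) - (?G x mu - ?G z mu)"
      have "?d \<bullet> v = (lam - mu) \<bullet> (p x - p z) v" for v
        using U V x by (simp add: blinfun.diff_left inner_diff_left inner_diff_right G)
      \<comment> \<open>Choosing \<open>v\<close> as the mixed difference itself turns the weak
        identity into a norm bound.\<close>
      then have "?d \<bullet> ?d = (lam - mu) \<bullet> (p x - p z) ?d" .
      also have "\<dots> \<le> norm (lam - mu) * norm ((p x - p z) ?d)"
        by (rule norm_cauchy_schwarz)
      also have "\<dots> \<le> norm (lam - mu) * (norm (p x - p z) * norm ?d)"
        by (intro mult_left_mono norm_blinfun norm_ge_zero)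
      also have "\<dots> \<le> norm (lam - mu) * (C * norm (x - z) * norm ?d)"
        using lip by (intro mult_left_mono mult_right_mono) auto
      finally have "norm ?d * norm ?d \<le> (C * norm (x - z) * norm (lam - mu)) * norm ?d"
        by (simp add: power2_norm_eq_inner[symmetric] power2_eq_square algebra_simps)
      moreover have "0 \<le> C * norm (x - z) * norm (lam - mu)"
        using C by simp
      ultimately show "norm ?d \<le> C * norm (x - z) * norm (lam - mu)"
        by (metis mult_right_le_imp_le norm_ge_zero order_le_less)
    qed
  qed
qed

section \<open>The second-order condition along degenerate sequences\<close>

text \<open>The scaled gradient at \<open>(X k, L k)\<close>, paired with the direction of
  \<open>X k - xbar\<close>, splits into a negligible mixed difference, a Hessian quotient at
  \<open>lbar\<close> and a multiplier term. The limit of this identity contradicts the strict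
  second-order inequality.\<close>

lemma SOSC_no_degenerate_sequence:
  fixes f :: "real ^ 'n \<Rightarrow> real" and \<Phi> :: "real ^ 'n \<Rightarrow> real \<times> (real ^ 'm)"
  assumes smooth: "C2_around f xbar" "C2_around \<Phi> xbar"
    and SOSC: "SOSC f \<Phi> xbar lbar" and lbar: "lbar \<in> multipliers f \<Phi> xbar"
    and X: "X \<longlonglongrightarrow> xbar" "\<And>k. X k \<noteq> xbar" and L: "L \<longlonglongrightarrow> lbar"
    and normal: "\<And>k. L k - E k \<in> normal_cone SOC (\<Phi> (X k) + E k)"
    and Nu: "\<And>k. Nu k \<in> multipliers f \<Phi> xbar"
    and E: "(\<lambda>k. E k /\<^sub>R norm (X k - xbar)) \<longlonglongrightarrow> 0"
    and GXL: "(\<lambda>k. grad_lagrangian f \<Phi> (X k) (L k) /\<^sub>R norm (X k - xbar)) \<longlonglongrightarrow> 0"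
    and w: "(\<lambda>k. (X k - xbar) /\<^sub>R norm (X k - xbar)) \<longlonglongrightarrow> w"
    and \<eta>: "(\<lambda>k. (L k - E k - Nu k) /\<^sub>R norm (X k - xbar)) \<longlonglongrightarrow> \<eta>"
  shows False
proof -
  let ?G = "grad_lagrangian f \<Phi>" and ?D = "frechet_derivative \<Phi> (at xbar)"
    and ?H = "hess_lagrangian f \<Phi> xbar lbar"
  obtain C where "C \<ge> 0" and D: "(\<Phi> has_derivative ?D) (at xbar)"
    and H': "\<And>lam. ((\<lambda>x. ?G x lam) has_derivative hess_lagrangian f \<Phi> xbar lam) (at xbar)"
    and GD: "\<And>lam mu v. (?G xbar lam - ?G xbar mu) \<bullet> v = (lam - mu) \<bullet> ?D v"
    and lip: "\<forall>\<^sub>F x in nhds xbar. \<forall>lam mu. norm ((?G x lam - ?G xbar lam) - (?G x mu - ?G xbar mu))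
           \<le> C * norm (x - xbar) * norm (lam - mu)"
    by (rule C2_around_lagrangian[OF smooth]) (rule that)
  note H = H'[of lbar]
  define t where "t k = norm (X k - xbar)" for k
  define W where "W k = (X k - xbar) /\<^sub>R t k" for k
  \<comment> \<open>The residual \<open>E k\<close> is included so that moving from
    \<open>\<Phi> xbar\<close> by \<open>t k\<close> along \<open>u k\<close> reaches exactly the
    point where \<open>L k - E k\<close> is normal. Being of smaller order, it does not affect the
    limit.\<close>
  define u where "u k = (\<Phi> (X k) + E k - \<Phi> xbar) /\<^sub>R t k" for k
  have tpos: "0 < t k" for k using X(2) by (simp add: t_def)
  have t0: "t \<longlonglongrightarrow> 0"
    unfolding t_def using tendsto_norm[OF tendsto_diff[OF X(1) tendsto_const[of xbar]]] by simp
  have Wlim: "W \<longlonglongrightarrow> w" using w by (simp add: W_def[abs_def] t_def)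
  have "norm (W k) = 1" for k
    using tpos[of k] by (simp add: W_def t_def)
  with tendsto_norm[OF Wlim] have "norm w = 1"
    by (simp add: LIMSEQ_const_iff)
  then have w0: "w \<noteq> 0" by auto
  have "(\<lambda>k. (\<Phi> (X k) - \<Phi> xbar) /\<^sub>R t k + E k /\<^sub>R t k) \<longlonglongrightarrow> ?D w + 0"
    unfolding t_def by (intro tendsto_add has_derivative_direction_seq[OF D X w] E)
  moreover have "(\<Phi> (X k) - \<Phi> xbar) /\<^sub>R t k + E k /\<^sub>R t k = u k" for k
    by (simp add: u_def algebra_simps)
  ultimately have ulim: "u \<longlonglongrightarrow> ?D w" by simp
  have yu: "\<Phi> xbar + t k *\<^sub>R u k = \<Phi> (X k) + E k" for k
    using tpos[of k] by (simp add: u_def)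
  have "(\<lambda>k. t k *\<^sub>R (E k /\<^sub>R t k)) \<longlonglongrightarrow> 0 *\<^sub>R 0"
    using t0 E unfolding t_def by (intro tendsto_scaleR)
  moreover have "t k *\<^sub>R (E k /\<^sub>R t k) = E k" for k
    using tpos[of k] by simp
  ultimately have "E \<longlonglongrightarrow> 0" by simp
  from tendsto_diff[OF L this] have mulim: "(\<lambda>k. L k - E k) \<longlonglongrightarrow> lbar" by simp
  have normal': "L k - E k \<in> normal_cone SOC (\<Phi> xbar + t k *\<^sub>R u k)" for k
    using normal by (simp add: yu)
  have crit: "?D w \<in> critical_cone SOC (\<Phi> xbar) lbar"
    and sub: "second_subderiv (indicator_fun SOC) (\<Phi> xbar) lbar (?D w) \<le> ereal (\<eta> \<bullet> ?D w)"
    using SOC_multiplier_limit[OF tpos t0 ulim _ _ normal' mulim \<eta>[folded t_def]] lbar Nu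
    by (auto simp: multipliers_def)
  have stat: "?G xbar lbar = 0" "\<And>k. ?G xbar (Nu k) = 0"
    using lbar Nu by (auto simp: multipliers_def)
  \<comment> \<open>No rate is known for \<open>L k\<close> tending to \<open>lbar\<close>. The
    mixed difference nevertheless carries a factor \<open>t k\<close> besides
    \<open>norm (L k - lbar)\<close>, so it vanishes after division by \<open>t k\<close>.\<close>
  define T where "T k = ((?G (X k) (L k) - ?G xbar (L k)) - (?G (X k) lbar - ?G xbar lbar)) /\<^sub>R t k" for k
  have T: "T \<longlonglongrightarrow> 0"
  proof (rule Lim_null_comparison)
    have "\<forall>\<^sub>F k in sequentially. \<forall>lam mu. norm ((?G (X k) lam - ?G xbar lam) - (?G (X k) mu - ?G xbar mu))
           \<le> C * norm (X k - xbar) * norm (lam - mu)"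
      using lip X(1) by (rule eventually_compose_filterlim)
    then show "\<forall>\<^sub>F k in sequentially. norm (T k) \<le> C * norm (L k - lbar)"
    proof eventually_elim
      case (elim k)
      have "norm ((?G (X k) (L k) - ?G xbar (L k)) - (?G (X k) lbar - ?G xbar lbar))
          \<le> t k * (C * norm (L k - lbar))"
        using elim[rule_format, of "L k" lbar] unfolding t_def by (simp only: mult_ac)
      then show ?case
        unfolding T_def norm_scaleR using tpos[of k] by (simp add: field_simps)
    qed
    show "(\<lambda>k. C * norm (L k - lbar)) \<longlonglongrightarrow> 0"
      using tendsto_mult[OF tendsto_const[of C] tendsto_norm[OF tendsto_diff[OF L tendsto_const[of lbar]]]] by simp
  qed
  have "(\<lambda>k. T k \<bullet> W k + ((?G (X k) lbar - ?G xbar lbar) /\<^sub>R t k) \<bullet> W k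
      + ((L k - E k - Nu k) /\<^sub>R t k + E k /\<^sub>R t k) \<bullet> ?D (W k))
    \<longlonglongrightarrow> 0 \<bullet> w + ?H w \<bullet> w + (\<eta> + 0) \<bullet> ?D w"
    unfolding t_def
    by (intro tendsto_add tendsto_inner T Wlim has_derivative_direction_seq[OF H X w] \<eta> E
        bounded_linear.tendsto[OF has_derivative_bounded_linear[OF D]])
  \<comment> \<open>Stationarity of \<open>Nu k\<close> turns the gradient at \<open>xbar\<close>
    into the action of \<open>L k - Nu k\<close> on the derivative; \<open>E k\<close> is added back
    because \<open>\<eta>\<close> is the limit for \<open>L k - E k - Nu k\<close>.\<close>
  moreover have "T k \<bullet> W k + ((?G (X k) lbar - ?G xbar lbar) /\<^sub>R t k) \<bullet> W k
      + ((L k - E k - Nu k) /\<^sub>R t k + E k /\<^sub>R t k) \<bullet> ?D (W k)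
      = (?G (X k) (L k) /\<^sub>R t k) \<bullet> W k" for k
  proof -
    have "(L k - E k - Nu k) /\<^sub>R t k + E k /\<^sub>R t k = (L k - Nu k) /\<^sub>R t k"
      by (simp add: algebra_simps)
    moreover have "((L k - Nu k) /\<^sub>R t k) \<bullet> ?D (W k) = (?G xbar (L k) /\<^sub>R t k) \<bullet> W k"
      using GD[of "L k" "Nu k" "W k"] by (simp add: stat)
    moreover have "T k + (?G (X k) lbar - ?G xbar lbar) /\<^sub>R t k + ?G xbar (L k) /\<^sub>R t k = ?G (X k) (L k) /\<^sub>R t k"
      by (simp add: T_def stat algebra_simps)
    ultimately show ?thesis by (simp only: inner_add_left[symmetric])
  qed
  moreover have "(\<lambda>k. (?G (X k) (L k) /\<^sub>R t k) \<bullet> W k) \<longlonglongrightarrow> 0 \<bullet> w"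
    unfolding t_def by (intro tendsto_inner GXL Wlim)
  ultimately have "0 \<bullet> w + ?H w \<bullet> w + (\<eta> + 0) \<bullet> ?D w = 0 \<bullet> w"
    by (simp only:) (rule LIMSEQ_unique)
  then have eq: "ereal (?H w \<bullet> w) + ereal (\<eta> \<bullet> ?D w) = 0"
    by simp
  have "0 < ereal (?H w \<bullet> w) + second_subderiv (indicator_fun SOC) (\<Phi> xbar) lbar (?D w)"
    using SOSC w0 crit unfolding SOSC_def by blast
  also have "\<dots> \<le> ereal (?H w \<bullet> w) + ereal (\<eta> \<bullet> ?D w)"
    using sub by (rule add_left_mono)
  finally show False unfolding eq by simp
qed

section \<open>Calmness and nearby multipliers\<close>

text \<open>The shifted multiplier \<open>lam - e\<close> is a value of the multiplier mapping at a
  perturbation of size \<open>O(norm (x - xbar) + \<sigma>)\<close>. Calmness then supplies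
  \<open>nu\<close>; the bound on the residual keeps perturbation and multiplier inside the
  neighbourhoods of calmness.\<close>

lemma calm_multiplier_estimate:
  fixes f :: "real ^ 'n \<Rightarrow> real" and \<Phi> :: "real ^ 'n \<Rightarrow> real \<times> (real ^ 'm)"
  assumes smooth: "C2_around f xbar" "C2_around \<Phi> xbar"
    and calm: "calm_at (multiplier_map f \<Phi> xbar) (0, 0) lbar"
  obtains \<delta> C where "\<delta> > 0" "C \<ge> 0"
    "\<And>x lam. norm (x - xbar) \<le> \<delta> \<Longrightarrow> norm (lam - lbar) \<le> \<delta> \<Longrightarrow> kkt_residual f \<Phi> x lam \<le> \<delta> \<Longrightarrow>
      \<exists>e nu. norm e \<le> kkt_residual f \<Phi> x lam \<and> lam - e \<in> normal_cone SOC (\<Phi> x + e) \<and>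
        nu \<in> multipliers f \<Phi> xbar \<and>
        norm (lam - e - nu) \<le> C * (norm (x - xbar) + kkt_residual f \<Phi> x lam)"
proof -
  let ?G = "grad_lagrangian f \<Phi>" and ?D = "frechet_derivative \<Phi> (at xbar)"
    and ?H = "hess_lagrangian f \<Phi> xbar lbar"
  obtain C0 where C0: "C0 \<ge> 0" and D: "(\<Phi> has_derivative ?D) (at xbar)"
    and H': "\<And>lam. ((\<lambda>x. ?G x lam) has_derivative hess_lagrangian f \<Phi> xbar lam) (at xbar)"
    and GD: "\<And>lam mu v. (?G xbar lam - ?G xbar mu) \<bullet> v = (lam - mu) \<bullet> ?D v"
    and lip: "\<forall>\<^sub>F x in nhds xbar. \<forall>lam mu. norm ((?G x lam - ?G xbar lam) - (?G x mu - ?G xbar mu))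
           \<le> C0 * norm (x - xbar) * norm (lam - mu)"
    by (rule C2_around_lagrangian[OF smooth]) (rule that)
  note H = H'[of lbar]
  obtain C1 where C1: "C1 \<ge> 0" and lip1: "\<forall>\<^sub>F x in nhds xbar. norm (\<Phi> x - \<Phi> xbar) \<le> C1 * norm (x - xbar)"
    using has_derivative_local_lipschitz[OF D] .
  obtain C2 where C2: "C2 \<ge> 0" and lip2: "\<forall>\<^sub>F x in nhds xbar. norm (?G x lbar - ?G xbar lbar) \<le> C2 * norm (x - xbar)"
    using has_derivative_local_lipschitz[OF H] .
  note blD = has_derivative_bounded_linear[OF D]
  define K where "K = onorm ?D"
  have K: "K \<ge> 0" unfolding K_def by (rule onorm_pos_le[OF blD])
  have GK: "norm (?G xbar lam - ?G xbar mu) \<le> K * norm (lam - mu)" for lam mu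
  proof -
    let ?d = "?G xbar lam - ?G xbar mu"
    have "norm ?d * norm ?d = (lam - mu) \<bullet> ?D ?d"
      using GD[of lam mu ?d] by (simp add: power2_norm_eq_inner[symmetric] power2_eq_square)
    also have "\<dots> \<le> norm (lam - mu) * norm (?D ?d)" by (rule norm_cauchy_schwarz)
    also have "\<dots> \<le> norm (lam - mu) * (K * norm ?d)"
      unfolding K_def by (intro mult_left_mono onorm[OF blD] norm_ge_zero)
    finally have "norm ?d * norm ?d \<le> (K * norm (lam - mu)) * norm ?d" by (simp add: ac_simps)
    moreover have "0 \<le> K * norm (lam - mu)" using K by simp
    ultimately show ?thesis by (metis mult_right_le_imp_le norm_ge_zero order_le_less)
  qed
  obtain \<rho> where \<rho>: "\<rho> > 0" and near: "\<And>x. norm (x - xbar) < \<rho> \<Longrightarrow>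
      (\<forall>lam mu. norm ((?G x lam - ?G xbar lam) - (?G x mu - ?G xbar mu))
           \<le> C0 * norm (x - xbar) * norm (lam - mu)) \<and>
      norm (\<Phi> x - \<Phi> xbar) \<le> C1 * norm (x - xbar) \<and>
      norm (?G x lbar - ?G xbar lbar) \<le> C2 * norm (x - xbar)"
    using eventually_conj[OF lip eventually_conj[OF lip1 lip2]]
    unfolding eventually_nhds_metric dist_norm by blast
  from calm obtain l U V where l: "l \<ge> 0" and U: "open U" "(0, 0) \<in> U" and V: "open V" "lbar \<in> V"
    and sub: "\<forall>p\<in>U. multiplier_map f \<Phi> xbar p \<inter> V
      \<subseteq> {a + (l * norm (p - (0, 0))) *\<^sub>R b | a b. a \<in> multiplier_map f \<Phi> xbar (0, 0) \<and> b \<in> cball 0 1}"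
    unfolding calm_at_def by (elim conjE exE) (rule that)
  obtain r1 where r1: "r1 > 0" "ball (0, 0) r1 \<subseteq> U"
    using openE[OF U] .
  obtain r2 where r2: "r2 > 0" "ball lbar r2 \<subseteq> V"
    using openE[OF V] .
  \<comment> \<open>In the bound for the perturbation, \<open>K + 2\<close> multiplies the residual
    and \<open>C0 + C1 + C2\<close> multiplies \<open>norm (x - xbar)\<close>; the sum covers
    both.\<close>
  define M where "M = K + 2 + C0 + C1 + C2"
  have M: "M > 0" using K C0 C1 C2 by (simp add: M_def)
  define q where "q = r1 / (4 * M)"
  have q: "q > 0" using r1(1) M by (simp add: q_def)
  \<comment> \<open>The bound 1 absorbs the factor \<open>norm (lam - lbar)\<close>,
    \<open>\<rho> / 2\<close> gives the local estimates, \<open>q\<close> puts the perturbation into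
    \<open>U\<close>, and \<open>r2 / 4\<close> puts \<open>lam - e\<close> into
    \<open>V\<close>.\<close>
  define \<delta> where "\<delta> = min (min 1 (\<rho> / 2)) (min q (r2 / 4))"
  have \<delta>: "\<delta> > 0" "\<delta> \<le> 1" "\<delta> < \<rho>" "\<delta> \<le> q" "2 * \<delta> < r2"
    using \<rho> r1(1) r2(1) q by (auto simp: \<delta>_def min_def)
  show ?thesis
  proof (rule that[of \<delta> "l * M"])
    show "\<delta> > 0" by (rule \<delta>)
    show "0 \<le> l * M" using l M by simp
    fix x lam
    let ?\<sigma> = "kkt_residual f \<Phi> x lam" and ?s = "norm (x - xbar)"
    assume x: "?s \<le> \<delta>" and lam: "norm (lam - lbar) \<le> \<delta>" and \<sigma>: "?\<sigma> \<le> \<delta>"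
    define e where "e = closest_point SOC (\<Phi> x + lam) - \<Phi> x"
    have e: "norm e \<le> ?\<sigma>" and g: "norm (?G x lam) \<le> ?\<sigma>"
      by (auto simp: e_def kkt_residual_def norm_minus_commute)
    have "SOC \<noteq> ({} :: (real \<times> (real ^ 'm)) set)" using zero_in_SOC by blast
    from closest_point_residual_normal[OF convex_SOC closed_SOC this, of "\<Phi> x + lam"]
    have N: "lam - e \<in> normal_cone SOC (\<Phi> x + e)"
      by (simp add: e_def algebra_simps)
    have near_x: "norm ((?G x lam - ?G xbar lam) - (?G x lbar - ?G xbar lbar)) \<le> C0 * ?s * norm (lam - lbar)"
      "norm (\<Phi> x - \<Phi> xbar) \<le> C1 * ?s" "norm (?G x lbar - ?G xbar lbar) \<le> C2 * ?s"
      using near[OF le_less_trans[OF x \<delta>(3)]] by blast+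
    define p where "p = (?G xbar (lam - e), \<Phi> x + e - \<Phi> xbar)"
    have "norm (?G xbar (lam - e) - ?G xbar lam) \<le> K * norm e"
      using GK[of "lam - e" lam] by simp
    moreover have "C0 * ?s * norm (lam - lbar) \<le> C0 * ?s * 1"
      using lam \<delta>(2) C0 by (intro mult_left_mono) auto
    \<comment> \<open>The comparison passes through \<open>lbar\<close>: the constant
      \<open>C2\<close> belongs to that multiplier alone, and the mixed difference transfers the
      estimate to \<open>lam\<close>.\<close>
    moreover have "norm (?G xbar (lam - e)) \<le> norm (?G xbar (lam - e) - ?G xbar lam)
        + norm ((?G x lam - ?G xbar lam) - (?G x lbar - ?G xbar lbar))
        + norm (?G x lbar - ?G xbar lbar) + norm (?G x lam)"
    proof -
      have "?G xbar (lam - e) = (?G xbar (lam - e) - ?G xbar lam)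
        - ((?G x lam - ?G xbar lam) - (?G x lbar - ?G xbar lbar))
        - (?G x lbar - ?G xbar lbar) + ?G x lam" by simp
      then show ?thesis
        by (smt (verit) norm_triangle_ineq norm_triangle_ineq4)
    qed
    ultimately have "norm (?G xbar (lam - e)) \<le> K * norm e + C0 * ?s + C2 * ?s + norm (?G x lam)"
      using near_x by linarith
    moreover have "norm (\<Phi> x + e - \<Phi> xbar) \<le> C1 * ?s + norm e"
      using near_x(2) norm_triangle_ineq[of "\<Phi> x - \<Phi> xbar" e] by (simp add: algebra_simps)
    moreover have "norm p \<le> norm (?G xbar (lam - e)) + norm (\<Phi> x + e - \<Phi> xbar)"
      unfolding p_def by (rule norm_Pair_le)
    moreover have "K * norm e \<le> K * ?\<sigma>" using e K by (rule mult_left_mono)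
    moreover have "0 \<le> C0 * ?\<sigma>" "0 \<le> C1 * ?\<sigma>" "0 \<le> C2 * ?\<sigma>" "0 \<le> K * ?s" "0 \<le> ?s"
      using C0 C1 C2 K order_trans[OF norm_ge_zero e] by auto
    moreover have "M * (?s + ?\<sigma>) = K * ?s + K * ?\<sigma> + 2 * ?s + 2 * ?\<sigma> + C0 * ?s + C0 * ?\<sigma>
        + C1 * ?s + C1 * ?\<sigma> + C2 * ?s + C2 * ?\<sigma>"
      by (simp add: M_def algebra_simps)
    ultimately have pM: "norm p \<le> M * (?s + ?\<sigma>)"
      using e g by linarith
    also have "\<dots> \<le> M * (2 * \<delta>)" using M x \<sigma> by (intro mult_left_mono) auto
    also have "\<dots> < r1" using M \<delta>(1,4) r1(1) by (simp add: q_def field_simps)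
    finally have "p \<in> ball (0, 0) r1" by (simp flip: zero_prod_def)
    with r1(2) have "p \<in> U" by (rule subsetD)
    moreover have "norm (lam - e - lbar) < r2"
      using norm_triangle_ineq4[of "lam - lbar" e] lam e \<sigma> \<delta>(5) by (simp add: algebra_simps)
    then have "lam - e \<in> ball lbar r2" by (simp only: mem_ball dist_norm norm_minus_commute)
    with r2(2) have "lam - e \<in> V" by (rule subsetD)
    moreover have "lam - e \<in> multiplier_map f \<Phi> xbar p"
      using N by (simp add: multiplier_map_def p_def)
    ultimately obtain nu b where nu: "nu \<in> multiplier_map f \<Phi> xbar (0, 0)" and b: "norm b \<le> 1"
      and eq: "lam - e = nu + (l * norm (p - (0, 0))) *\<^sub>R b"
      using sub[rule_format, of p] by auto
    have "norm (lam - e - nu) = l * norm p * norm b"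
      using eq l by (simp add: zero_prod_def[symmetric] algebra_simps)
    also have "\<dots> \<le> l * norm p" using b l by (simp add: mult_left_le)
    also have "\<dots> \<le> l * M * (?s + ?\<sigma>)" using mult_left_mono[OF pM l] by (simp add: mult.assoc)
    finally have "norm (lam - e - nu) \<le> l * M * (?s + ?\<sigma>)" .
    moreover have "nu \<in> multipliers f \<Phi> xbar"
      using nu by (simp add: multiplier_map_def multipliers_def)
    ultimately show "\<exists>e nu. norm e \<le> ?\<sigma> \<and> lam - e \<in> normal_cone SOC (\<Phi> x + e) \<and>
        nu \<in> multipliers f \<Phi> xbar \<and> norm (lam - e - nu) \<le> l * M * (?s + ?\<sigma>)"
      using e N by blast
  qed
qed

lemma grad_lagrangian_le_kkt_residual: "norm (grad_lagrangian f \<Phi> x lam) \<le> kkt_residual f \<Phi> x lam"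
  by (simp add: kkt_residual_def)

section \<open>The primal error bound\<close>

text \<open>A failure for all radii and constants yields a sequence whose residual is negligible
  against \<open>norm (x - xbar)\<close>. Calmness keeps the scaled multiplier differences bounded,
  so compactness produces a degenerate sequence excluded by the second-order condition.\<close>

lemma SOSC_calm_primal_estimate:
  fixes f :: "real ^ 'n \<Rightarrow> real" and \<Phi> :: "real ^ 'n \<Rightarrow> real \<times> (real ^ 'm)"
  assumes smooth: "C2_around f xbar" "C2_around \<Phi> xbar"
    and SOSC: "SOSC f \<Phi> xbar lbar"
    and lbar: "lbar \<in> multipliers f \<Phi> xbar"
    and calm: "calm_at (multiplier_map f \<Phi> xbar) (0, 0) lbar"
  obtains \<gamma> \<kappa> where "\<gamma> > 0" "\<kappa> \<ge> 0"
    "\<And>x lam. norm (x - xbar) \<le> \<gamma> \<Longrightarrow> norm (lam - lbar) \<le> \<gamma> \<Longrightarrow> norm (x - xbar) \<le> \<kappa> * kkt_residual f \<Phi> x lam"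
proof -
  let ?\<sigma> = "kkt_residual f \<Phi>"
  obtain \<delta> C where \<delta>: "\<delta> > 0" and C: "C \<ge> 0"
    and est: "\<And>x lam. norm (x - xbar) \<le> \<delta> \<Longrightarrow> norm (lam - lbar) \<le> \<delta> \<Longrightarrow> ?\<sigma> x lam \<le> \<delta> \<Longrightarrow>
      \<exists>e nu. norm e \<le> ?\<sigma> x lam \<and> lam - e \<in> normal_cone SOC (\<Phi> x + e) \<and>
        nu \<in> multipliers f \<Phi> xbar \<and> norm (lam - e - nu) \<le> C * (norm (x - xbar) + ?\<sigma> x lam)"
    using calm_multiplier_estimate[OF smooth calm] by blast
  have "\<exists>\<gamma>>0. \<exists>\<kappa>\<ge>0. \<forall>x lam. norm (x - xbar) \<le> \<gamma> \<longrightarrow> norm (lam - lbar) \<le> \<gamma> \<longrightarrow>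
      norm (x - xbar) \<le> \<kappa> * ?\<sigma> x lam"
  proof (rule ccontr)
    assume "\<not> ?thesis"
    then have "\<exists>x lam. norm (x - xbar) \<le> \<gamma> \<and> norm (lam - lbar) \<le> \<gamma> \<and> \<kappa> * ?\<sigma> x lam < norm (x - xbar)"
      if "\<gamma> > 0" "\<kappa> \<ge> 0" for \<gamma> \<kappa>
      using that by (meson not_le)
    \<comment> \<open>Shrinking radii give convergence while staying within reach of
      \<open>est\<close>; growing constants bound the ratio of residual to distance by
      \<open>1 / real (Suc k)\<close>.\<close>
    from this[of "\<delta> / real (Suc k)" "real (Suc k)" for k]
    have "\<exists>x lam. norm (x - xbar) \<le> \<delta> / real (Suc k) \<and> norm (lam - lbar) \<le> \<delta> / real (Suc k) \<and>
        real (Suc k) * ?\<sigma> x lam < norm (x - xbar)" for k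
      using \<delta> by simp
    then obtain X L where X: "\<And>k. norm (X k - xbar) \<le> \<delta> / real (Suc k)"
      and L: "\<And>k. norm (L k - lbar) \<le> \<delta> / real (Suc k)"
      and bad: "\<And>k. real (Suc k) * ?\<sigma> (X k) (L k) < norm (X k - xbar)"
      by metis
    define t where "t k = norm (X k - xbar)" for k
    have \<sigma>0: "0 \<le> ?\<sigma> x lam" for x lam by (simp add: kkt_residual_def)
    have tpos: "0 < t k" for k
      using bad[of k] \<sigma>0[of "X k" "L k"] unfolding t_def
      by (meson le_less_trans mult_nonneg_nonneg of_nat_0_le_iff)
    have \<sigma>t: "?\<sigma> (X k) (L k) / t k \<le> 1 / real (Suc k)" for k
      using bad[of k] tpos[of k] unfolding t_def by (simp add: field_simps)
    have k1: "1 / real (Suc k) \<le> 1" for k by simp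
    have small: "\<delta> / real (Suc k) \<le> \<delta>" for k using mult_left_mono[OF k1[of k], of \<delta>] \<delta> by simp
    have \<sigma>le: "?\<sigma> (X k) (L k) \<le> t k" for k
      using order_trans[OF \<sigma>t[of k] k1[of k]] tpos[of k] by simp
    have t\<delta>: "t k \<le> \<delta>" for k using X[of k] small[of k] by (simp add: t_def)
    have "\<exists>e nu. norm e \<le> ?\<sigma> (X k) (L k) \<and> L k - e \<in> normal_cone SOC (\<Phi> (X k) + e) \<and>
        nu \<in> multipliers f \<Phi> xbar \<and> norm (L k - e - nu) \<le> C * (norm (X k - xbar) + ?\<sigma> (X k) (L k))" for k
      using t\<delta>[of k] order_trans[OF L[of k] small[of k]] \<sigma>le[of k] by (intro est) (auto simp: t_def)
    then obtain E Nu where E: "\<And>k. norm (E k) \<le> ?\<sigma> (X k) (L k)"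
      and N: "\<And>k. L k - E k \<in> normal_cone SOC (\<Phi> (X k) + E k)"
      and Nu: "\<And>k. Nu k \<in> multipliers f \<Phi> xbar"
      and LEN: "\<And>k. norm (L k - E k - Nu k) \<le> C * (t k + ?\<sigma> (X k) (L k))"
      unfolding t_def by metis
    have inv0: "(\<lambda>k. c / real (Suc k)) \<longlonglongrightarrow> 0" for c :: real
      using tendsto_mult[OF tendsto_const[of c] LIMSEQ_inverse_real_of_nat] by (simp add: divide_inverse)
    have "(\<lambda>k. X k - xbar) \<longlonglongrightarrow> 0" "(\<lambda>k. L k - lbar) \<longlonglongrightarrow> 0"
      using X L by (auto intro!: Lim_null_comparison[OF _ inv0[of \<delta>]])
    then have Xlim: "X \<longlonglongrightarrow> xbar" and Llim: "L \<longlonglongrightarrow> lbar"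
      by (simp_all add: LIM_zero_iff)
    have vanish: "(\<lambda>k. v k /\<^sub>R t k) \<longlonglongrightarrow> 0"
      if "\<And>k. norm (v k) \<le> ?\<sigma> (X k) (L k)" for v :: "nat \<Rightarrow> 'z::real_normed_vector"
    proof (rule Lim_null_comparison[OF _ inv0[of 1]], intro always_eventually allI)
      fix k
      have "norm (v k /\<^sub>R t k) = norm (v k) / t k" using tpos[of k] by (simp add: divide_inverse_commute)
      also have "\<dots> \<le> ?\<sigma> (X k) (L k) / t k" using that[of k] tpos[of k] by (intro divide_right_mono) auto
      finally show "norm (v k /\<^sub>R t k) \<le> 1 / real (Suc k)" using \<sigma>t[of k] by linarith
    qed
    \<comment> \<open>Pairing direction and multiplier quotient lets one subsequence serve both
      limits. The first component has norm 1, the second at most \<open>2 * C\<close> because the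
      residual is at most \<open>t k\<close>.\<close>
    define Z where "Z k = ((X k - xbar) /\<^sub>R t k, (L k - E k - Nu k) /\<^sub>R t k)" for k
    have "norm (Z k) \<le> 1 + 2 * C" for k
    proof -
      have "norm ((X k - xbar) /\<^sub>R t k) = 1" using tpos[of k] by (simp add: t_def)
      moreover have "norm (L k - E k - Nu k) \<le> C * (2 * t k)"
        using LEN[of k] mult_left_mono[OF _ C, of "t k + ?\<sigma> (X k) (L k)" "2 * t k"] \<sigma>le[of k] by simp
      then have "norm ((L k - E k - Nu k) /\<^sub>R t k) \<le> 2 * C"
        using tpos[of k] by (simp only: norm_scaleR) (simp add: field_simps)
      ultimately show ?thesis
        unfolding Z_def using norm_Pair_le by (smt (verit))
    qed
    then have "bounded (range Z)" by (auto simp: bounded_iff)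
    then obtain z r where r: "strict_mono r" and z: "(Z \<circ> r) \<longlonglongrightarrow> z"
      using bounded_imp_convergent_subsequence by blast
    note subseq = LIMSEQ_subseq_LIMSEQ[OF _ r, unfolded o_def]
    have zf: "(\<lambda>k. (X (r k) - xbar) /\<^sub>R norm (X (r k) - xbar)) \<longlonglongrightarrow> fst z"
      and zs: "(\<lambda>k. (L (r k) - E (r k) - Nu (r k)) /\<^sub>R norm (X (r k) - xbar)) \<longlonglongrightarrow> snd z"
      using tendsto_fst[OF z] tendsto_snd[OF z] by (simp_all add: Z_def o_def t_def)
    show False
      using SOSC_no_degenerate_sequence[OF smooth SOSC lbar subseq[OF Xlim] _ subseq[OF Llim] N Nu _ _ zf zs]
        subseq[OF vanish[OF E]] subseq[OF vanish[OF grad_lagrangian_le_kkt_residual]] tpos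
      by (auto simp: t_def)
  qed
  then show ?thesis using that by blast
qed

section \<open>The primal-dual error bound\<close>

theorem theorem3p1:
  fixes f :: "real ^ 'n \<Rightarrow> real"
    and \<Phi> :: "real ^ 'n \<Rightarrow> real \<times> (real ^ 'm)"
    and xbar :: "real ^ 'n"
    and lbar :: "real \<times> (real ^ 'm)"
  assumes "C2_around f xbar"
    and "C2_around \<Phi> xbar"
    and "KKT f \<Phi> xbar lbar"
    and "SOSC f \<Phi> xbar lbar"
    and "calm_at (multiplier_map f \<Phi> xbar) (0, 0) lbar"
  shows "\<exists>\<gamma>\<^sub>1>0. \<exists>\<kappa>\<^sub>1\<ge>0. \<forall>(x, lam)\<in>cball (xbar, lbar) \<gamma>\<^sub>1.
           norm (x - xbar) + infdist lam (multipliers f \<Phi> xbar) \<le> \<kappa>\<^sub>1 * kkt_residual f \<Phi> x lam"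
proof -
  let ?\<sigma> = "kkt_residual f \<Phi>" and ?\<Lambda> = "multipliers f \<Phi> xbar"
  have lbar: "lbar \<in> ?\<Lambda>"
    using assms(5) by (simp add: calm_at_def multiplier_map_def multipliers_def)
  obtain \<delta> C where \<delta>: "\<delta> > 0" and C: "C \<ge> 0"
    and est: "\<And>x lam. norm (x - xbar) \<le> \<delta> \<Longrightarrow> norm (lam - lbar) \<le> \<delta> \<Longrightarrow> ?\<sigma> x lam \<le> \<delta> \<Longrightarrow>
      \<exists>e nu. norm e \<le> ?\<sigma> x lam \<and> lam - e \<in> normal_cone SOC (\<Phi> x + e) \<and>
        nu \<in> ?\<Lambda> \<and> norm (lam - e - nu) \<le> C * (norm (x - xbar) + ?\<sigma> x lam)"
    using calm_multiplier_estimate[OF assms(1,2,5)] by blast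
  obtain \<gamma> \<kappa> where \<gamma>: "\<gamma> > 0" and \<kappa>: "\<kappa> \<ge> 0"
    and primal: "\<And>x lam. norm (x - xbar) \<le> \<gamma> \<Longrightarrow> norm (lam - lbar) \<le> \<gamma> \<Longrightarrow> norm (x - xbar) \<le> \<kappa> * ?\<sigma> x lam"
    using SOSC_calm_primal_estimate[OF assms(1,2,4) lbar assms(5)] by blast
  \<comment> \<open>The terms pay for \<open>norm (x - xbar)\<close>, for
    \<open>lam - e - nu\<close> and, within the summand 2, for \<open>e\<close>. The summand 2 also
    covers the case of a large residual.\<close>
  define c where "c = \<kappa> + C * (\<kappa> + 1) + 2"
  have c: "c \<ge> 2" using \<kappa> C by (simp add: c_def)
  have bound: "norm (x - xbar) + infdist lam ?\<Lambda> \<le> c * ?\<sigma> x lam"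
    if x: "norm (x - xbar) \<le> min \<gamma> \<delta>" and lam: "norm (lam - lbar) \<le> min \<gamma> \<delta>" for x lam
  proof (cases "?\<sigma> x lam \<le> \<delta>")
    case True
    then obtain e nu where e: "norm e \<le> ?\<sigma> x lam" and nu: "nu \<in> ?\<Lambda>"
      and d: "norm (lam - e - nu) \<le> C * (norm (x - xbar) + ?\<sigma> x lam)"
      using est[of x lam] x lam by auto
    have p: "norm (x - xbar) \<le> \<kappa> * ?\<sigma> x lam" using primal x lam by simp
    have "infdist lam ?\<Lambda> \<le> norm (lam - nu)"
      using infdist_le[OF nu, of lam] by (simp add: dist_norm)
    also have "\<dots> \<le> norm (lam - e - nu) + norm e"
      using norm_triangle_ineq[of "lam - e - nu" e] by simp
    also have "\<dots> \<le> C * (\<kappa> * ?\<sigma> x lam + ?\<sigma> x lam) + ?\<sigma> x lam"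
      using d e p mult_left_mono[OF add_right_mono[OF p] C, of "?\<sigma> x lam"] by linarith
    finally show ?thesis
      using p order_trans[OF norm_ge_zero e] by (simp add: c_def algebra_simps)
  next
    \<comment> \<open>A residual above \<open>\<delta>\<close> already dominates both distances,
      with \<open>lbar\<close> itself as the comparison multiplier.\<close>
    case False
    have "infdist lam ?\<Lambda> \<le> norm (lam - lbar)"
      using infdist_le[OF lbar, of lam] by (simp add: dist_norm)
    then have "norm (x - xbar) + infdist lam ?\<Lambda> \<le> 2 * ?\<sigma> x lam"
      using x lam False by linarith
    also have "\<dots> \<le> c * ?\<sigma> x lam"
      using c False \<delta> by (intro mult_right_mono) auto
    finally show ?thesis .
  qed
  have "norm (x - xbar) + infdist lam ?\<Lambda> \<le> c * ?\<sigma> x lam"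
    if "(x, lam) \<in> cball (xbar, lbar) (min \<gamma> \<delta>)" for x lam
  proof (rule bound)
    have "norm ((x, lam) - (xbar, lbar)) \<le> min \<gamma> \<delta>"
      using that by (simp only: mem_cball dist_norm norm_minus_commute)
    then show "norm (x - xbar) \<le> min \<gamma> \<delta>" "norm (lam - lbar) \<le> min \<gamma> \<delta>"
      using norm_fst_le[of "x - xbar" "lam - lbar"] norm_snd_le[of "lam - lbar" "x - xbar"] by auto
  qed
  then show ?thesis
    using \<gamma> \<delta> c by (intro exI[of _ "min \<gamma> \<delta>"] conjI exI[of _ c]) auto
qed

end
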